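(* The mapping $f\mapsto S_f$ is a one-to-one correspondence (bijection) between $\mathcal{S}$ and $\mathcal{M}$ that transforms $\mathcal{S}^\circ$ onto $\mathcal{M}^\circ$.
   Context: $\mathbb{R}_+=(0,\infty)$. $\mathcal{M}$ is the set of functions $M:\mathbb{R}_+^2\to\mathbb{R}$ (called means) such that for all $x,y>0$: (A) $M(x,y)=M(y,x)$; (B) $M(\lambda x,\lambda y)=\lambda M(x,y)$ for all $\lambda>0$; (C) $\min(x,y)\leqslant M(x,y)\leqslant\max(x,y)$. $\mathcal{M}^\circ$ is the set of $M\in\mathcal{M}$ that are strict, i.e. $\min(x,y)<M(x,y)<\max(x,y)$ whenever $x\neq y$. $\mathcal{S}$ is the set of functions $f:(0,1)\to\mathbb{R}$ (called Seiffert functions) satisfying $\frac{z}{1+z}\leqslant f(z)\leqslant\frac{z}{1-z}$ for all $z\in(0,1)$; $\mathcal{S}^\circ$ is the subset of those $f\in\mathcal{S}$ for which both inequalities are strict for all $z\in(0,1)$. For $f\in\mathcal{S}$ and $x,y>0$, $S_f(x,y)=\dfrac{|x-y|}{2f\left(\frac{|x-y|}{x+y}\right)}$ if $x\neq y$, and $S_f(x,x)=x$. *)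

theory Defs imports Complex_Main "HOL-Library.FuncSet" begin

text \<open>
  Functions on \<open>(0,\<infinity>)\<^sup>2\<close> and on \<open>(0,1)\<close> are total HOL functions that are extensional on
  their domain, i.e. have the value \<^const>\<open>undefined\<close> outside of it. Hence two of them are equal
  iff they agree on the domain, and the sets below are the sets of functions with that
  domain.
\<close>

abbreviation pos_pairs :: "(real \<times> real) set" where
  "pos_pairs \<equiv> {0<..} \<times> {0<..}"

definition means :: "(real \<times> real \<Rightarrow> real) set" where
  "means = {M \<in> extensional pos_pairs.
     (\<forall>x>0. \<forall>y>0. M (x, y) = M (y, x)) \<and>
     (\<forall>x>0. \<forall>y>0. \<forall>l>0. M (l * x, l * y) = l * M (x, y)) \<and>
     (\<forall>x>0. \<forall>y>0. min x y \<le> M (x, y) \<and> M (x, y) \<le> max x y)}"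

definition strict_means :: "(real \<times> real \<Rightarrow> real) set" where
  "strict_means = {M \<in> means.
     \<forall>x>0. \<forall>y>0. x \<noteq> y \<longrightarrow> min x y < M (x, y) \<and> M (x, y) < max x y}"

definition seiffert_functions :: "(real \<Rightarrow> real) set" where
  "seiffert_functions = {f \<in> extensional {0<..<1}.
     \<forall>z\<in>{0<..<1}. z / (1 + z) \<le> f z \<and> f z \<le> z / (1 - z)}"

definition strict_seiffert_functions :: "(real \<Rightarrow> real) set" where
  "strict_seiffert_functions = {f \<in> seiffert_functions.
     \<forall>z\<in>{0<..<1}. z / (1 + z) < f z \<and> f z < z / (1 - z)}"

definition seiffert_mean :: "(real \<Rightarrow> real) \<Rightarrow> real \<times> real \<Rightarrow> real" where
  "seiffert_mean f = (\<lambda>(x, y)\<in>pos_pairs.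
     if x = y then x else \<bar>x - y\<bar> / (2 * f (\<bar>x - y\<bar> / (x + y))))"

end

theory Submission imports Defs begin

text \<open>
  Symmetry and homogeneity determine a mean off the diagonal by its values at the pairs
  \<open>(1 + z, 1 - z)\<close> with \<open>0 < z < 1\<close>: up to order, every pair \<open>x \<noteq> y\<close> is the multiple
  \<open>(x + y) / 2\<close> of the pair with \<open>z = \<bar>x - y\<bar> / (x + y)\<close> (\<open>mean_normal_form\<close>); on the diagonal
  the bounds force the value \<open>x\<close>. At \<open>(1 + z, 1 - z)\<close> the function \<open>S\<^sub>f\<close> takes the value
  \<open>z / f z\<close>, and the mean property \<open>1 - z \<le> z / f z \<le> 1 + z\<close> is the Seiffert condition
  \<open>z / (1 + z) \<le> f z \<le> z / (1 - z)\<close> after taking reciprocals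
  (\<open>seiffert_bounds_iff_mean_bounds\<close>). So \<open>f \<mapsto> S\<^sub>f\<close> is inverted by
  \<open>M \<mapsto> (z \<mapsto> z / M (1 + z, 1 - z))\<close>. Reciprocals respect strict inequalities as well, so
  \<open>S\<^sub>f\<close> is strict exactly when \<open>f\<close> is (\<open>seiffert_mean_strict_iff\<close>), and a bijection with this
  property maps the strict functions onto the strict means.
\<close>

abbreviation gap_ratio :: "real \<Rightarrow> real \<Rightarrow> real" where
  "gap_ratio x y \<equiv> \<bar>x - y\<bar> / (x + y)"

definition seiffert_function :: "(real \<times> real \<Rightarrow> real) \<Rightarrow> real \<Rightarrow> real" where
  "seiffert_function M = (\<lambda>z\<in>{0<..<1}. z / M (1 + z, 1 - z))"

lemma gap_ratio_in_unit_interval: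
  assumes "0 < x" "0 < y" "x \<noteq> y"
  shows "gap_ratio x y \<in> {0<..<1}"
  using assms by (auto simp: field_simps)

lemma max_min_eq_scaled_pair:
  assumes "0 < x" "0 < y"
  shows "max x y = (x + y) / 2 * (1 + gap_ratio x y)"
    and "min x y = (x + y) / 2 * (1 - gap_ratio x y)"
proof -
  have half_gap: "(x + y) / 2 * gap_ratio x y = \<bar>x - y\<bar> / 2"
    using assms by (simp add: field_simps)
  show "max x y = (x + y) / 2 * (1 + gap_ratio x y)"
    unfolding distrib_left half_gap by (simp add: max_def field_simps)
  show "min x y = (x + y) / 2 * (1 - gap_ratio x y)"
    unfolding right_diff_distrib half_gap by (simp add: min_def field_simps)
qed

lemma seiffert_mean_normal_form:
  assumes "0 < x" "0 < y" "x \<noteq> y"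
  shows "seiffert_mean f (x, y) = (x + y) / 2 * (gap_ratio x y / f (gap_ratio x y))"
  using assms by (simp add: seiffert_mean_def)

lemma mean_normal_form:
  assumes M: "M \<in> means" and pos: "0 < x" "0 < y" "x \<noteq> y"
  shows "M (x, y) = (x + y) / 2 * M (1 + gap_ratio x y, 1 - gap_ratio x y)"
proof -
  \<comment> \<open>Symmetry orders the pair, so that the absolute value in \<open>gap_ratio\<close> loses nothing.\<close>
  have "M (x, y) = M (max x y, min x y)"
    using M pos by (auto simp: means_def max_def min_def)
  also have "\<dots> = M ((x + y) / 2 * (1 + gap_ratio x y), (x + y) / 2 * (1 - gap_ratio x y))"
    by (simp only: max_min_eq_scaled_pair[OF pos(1,2)])
  also have "\<dots> = (x + y) / 2 * M (1 + gap_ratio x y, 1 - gap_ratio x y)"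
  proof -
    have "0 < gap_ratio x y" "gap_ratio x y < 1"
      using gap_ratio_in_unit_interval[OF pos] by (simp_all only: greaterThanLessThan_iff)
    then have "0 < 1 + gap_ratio x y" "0 < 1 - gap_ratio x y"
      by linarith+
    moreover have "0 < (x + y) / 2"
      using pos by simp
    ultimately show ?thesis
      using M unfolding means_def by blast
  qed
  finally show ?thesis .
qed

text \<open>
  Read with \<open>w = f z\<close>: the decreasing involution \<open>w \<mapsto> z / w\<close> carries the bounds on a
  Seiffert function to the bounds on a mean of \<open>1 + z\<close> and \<open>1 - z\<close>.
\<close>

lemma seiffert_bounds_iff_mean_bounds:
  fixes z w :: real
  assumes "z \<in> {0<..<1}" "0 < w"
  shows "z / (1 + z) \<le> w \<longleftrightarrow> z / w \<le> 1 + z"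
    and "w \<le> z / (1 - z) \<longleftrightarrow> 1 - z \<le> z / w"
    and "z / (1 + z) < w \<longleftrightarrow> z / w < 1 + z"
    and "w < z / (1 - z) \<longleftrightarrow> 1 - z < z / w"
  using assms by (auto simp: field_simps)

lemma seiffert_function_pos:
  assumes "f \<in> seiffert_functions" "z \<in> {0<..<1}"
  shows "0 < f z"
proof -
  have "0 < z / (1 + z)" "z / (1 + z) \<le> f z"
    using assms by (auto simp: seiffert_functions_def)
  then show ?thesis by linarith
qed

lemma seiffert_mean_in_means:
  assumes f: "f \<in> seiffert_functions"
  shows "seiffert_mean f \<in> means"
proof -
  have "min x y \<le> seiffert_mean f (x, y) \<and> seiffert_mean f (x, y) \<le> max x y"
    if pos: "0 < x" "0 < y" for x y
  proof (cases "x = y")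
    case True
    with pos show ?thesis by (simp add: seiffert_mean_def)
  next
    case False
    define z where "z = gap_ratio x y"
    have z: "z \<in> {0<..<1}"
      using gap_ratio_in_unit_interval[OF pos False] by (simp only: z_def)
    have "1 - z \<le> z / f z" "z / f z \<le> 1 + z"
      using f z seiffert_bounds_iff_mean_bounds(1,2)[OF z seiffert_function_pos[OF f z]]
      by (auto simp: seiffert_functions_def)
    then show ?thesis
      unfolding max_min_eq_scaled_pair[OF pos] seiffert_mean_normal_form[OF pos False]
        z_def[symmetric]
      using pos by (intro conjI mult_left_mono) auto
  qed
  moreover have "seiffert_mean f (l * x, l * y) = l * seiffert_mean f (x, y)"
    if "0 < x" "0 < y" "0 < l" for x y l
  proof -
    have "gap_ratio (l * x) (l * y) = gap_ratio x y" "\<bar>l * x - l * y\<bar> = l * \<bar>x - y\<bar>"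
      using that by (simp_all add: abs_mult flip: distrib_left right_diff_distrib)
    with that show ?thesis
      by (simp add: seiffert_mean_def)
  qed
  moreover have "seiffert_mean f (x, y) = seiffert_mean f (y, x)" if "0 < x" "0 < y" for x y
    using that by (simp add: seiffert_mean_def abs_minus_commute add.commute)
  ultimately show ?thesis
    by (auto simp: means_def seiffert_mean_def)
qed

lemma mean_bounds_normalised_pair:
  assumes "M \<in> means" "z \<in> {0<..<1}"
  shows "1 - z \<le> M (1 + z, 1 - z)" "M (1 + z, 1 - z) \<le> 1 + z"
proof -
  have "0 < 1 + z" "0 < 1 - z" "min (1 + z) (1 - z) = 1 - z" "max (1 + z) (1 - z) = 1 + z"
    using assms(2) by auto
  moreover have "min x y \<le> M (x, y) \<and> M (x, y) \<le> max x y" if "0 < x" "0 < y" for x y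
    using assms(1) that unfolding means_def by blast
  ultimately show "1 - z \<le> M (1 + z, 1 - z)" "M (1 + z, 1 - z) \<le> 1 + z"
    by metis+
qed

lemma seiffert_function_in_seiffert_functions:
  assumes M: "M \<in> means"
  shows "seiffert_function M \<in> seiffert_functions"
proof -
  have "z / (1 + z) \<le> z / M (1 + z, 1 - z) \<and> z / M (1 + z, 1 - z) \<le> z / (1 - z)"
    if z: "z \<in> {0<..<1}" for z
    using mean_bounds_normalised_pair[OF M z] z by (auto intro!: divide_left_mono)
  then show ?thesis
    by (auto simp: seiffert_functions_def seiffert_function_def)
qed

lemma seiffert_mean_normalised_pair:
  assumes "z \<in> {0<..<1}"
  shows "seiffert_mean f (1 + z, 1 - z) = z / f z"
  using assms by (simp add: seiffert_mean_def)

lemma seiffert_function_seiffert_mean: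
  assumes f: "f \<in> seiffert_functions"
  shows "seiffert_function (seiffert_mean f) = f"
proof (rule extensionalityI)
  show "seiffert_function (seiffert_mean f) \<in> extensional {0<..<1}"
    by (simp add: seiffert_function_def)
  show "f \<in> extensional {0<..<1}"
    using f by (simp add: seiffert_functions_def)
  show "seiffert_function (seiffert_mean f) z = f z" if z: "z \<in> {0<..<1}" for z
    using z seiffert_function_pos[OF f z]
    by (simp add: seiffert_function_def seiffert_mean_normalised_pair)
qed

lemma seiffert_mean_seiffert_function:
  assumes M: "M \<in> means"
  shows "seiffert_mean (seiffert_function M) = M"
proof (rule extensionalityI)
  show "seiffert_mean (seiffert_function M) \<in> extensional pos_pairs"
    by (simp add: seiffert_mean_def)
  show "M \<in> extensional pos_pairs"
    using M by (simp add: means_def)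
  fix p :: "real \<times> real"
  assume "p \<in> pos_pairs"
  then obtain x y where p: "p = (x, y)" and pos: "0 < x" "0 < y"
    by auto
  show "seiffert_mean (seiffert_function M) p = M p"
  proof (cases "x = y")
    case True
    have "min x x \<le> M (x, x)" "M (x, x) \<le> max x x"
      using M pos unfolding means_def by blast+
    with True pos p show ?thesis
      by (simp add: seiffert_mean_def)
  next
    case False
    have "z / seiffert_function M z = M (1 + z, 1 - z)" if "z \<in> {0<..<1}" for z
      using that by (simp add: seiffert_function_def)
    note this[OF gap_ratio_in_unit_interval[OF pos False]]
    then show ?thesis
      unfolding p seiffert_mean_normal_form[OF pos False] mean_normal_form[OF M pos False]
      by (rule arg_cong)
  qed
qed

lemma bij_betw_seiffert_mean: "bij_betw seiffert_mean seiffert_functions means"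
  by (rule bij_betw_byWitness[where f' = seiffert_function])
    (auto simp: seiffert_function_seiffert_mean seiffert_mean_seiffert_function
      seiffert_mean_in_means seiffert_function_in_seiffert_functions)

text \<open>
  Strictness of the mean at the single pair \<open>(1 + z, 1 - z)\<close> already gives strictness of \<open>f\<close>
  at \<open>z\<close>; conversely, scaling carries strictness from these pairs to all others. The
  equivalence, rather than one implication, is what makes the image of the strict Seiffert
  functions all of the strict means.
\<close>

lemma seiffert_mean_strict_iff:
  assumes f: "f \<in> seiffert_functions"
  shows "seiffert_mean f \<in> strict_means \<longleftrightarrow> f \<in> strict_seiffert_functions"
proof
  assume strict: "seiffert_mean f \<in> strict_means"
  have "z / (1 + z) < f z \<and> f z < z / (1 - z)" if z: "z \<in> {0<..<1}" for z
  proof -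
    have "0 < 1 + z" "0 < 1 - z" "1 + z \<noteq> 1 - z"
      "min (1 + z) (1 - z) = 1 - z" "max (1 + z) (1 - z) = 1 + z"
      using z by auto
    moreover have "min x y < seiffert_mean f (x, y) \<and> seiffert_mean f (x, y) < max x y"
      if "0 < x" "0 < y" "x \<noteq> y" for x y
      using strict that unfolding strict_means_def by blast
    ultimately have "1 - z < seiffert_mean f (1 + z, 1 - z)"
      "seiffert_mean f (1 + z, 1 - z) < 1 + z"
      by metis+
    then show ?thesis
      unfolding seiffert_mean_normalised_pair[OF z]
      by (simp add: seiffert_bounds_iff_mean_bounds(3,4)[OF z seiffert_function_pos[OF f z]])
  qed
  with f show "f \<in> strict_seiffert_functions"
    by (simp add: strict_seiffert_functions_def)
next
  assume strict: "f \<in> strict_seiffert_functions"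
  have "min x y < seiffert_mean f (x, y) \<and> seiffert_mean f (x, y) < max x y"
    if pos: "0 < x" "0 < y" "x \<noteq> y" for x y
  proof -
    define z where "z = gap_ratio x y"
    have z: "z \<in> {0<..<1}"
      using gap_ratio_in_unit_interval[OF pos] by (simp only: z_def)
    have "1 - z < z / f z" "z / f z < 1 + z"
      using strict z seiffert_bounds_iff_mean_bounds(3,4)[OF z seiffert_function_pos[OF f z]]
      by (auto simp: strict_seiffert_functions_def)
    then show ?thesis
      unfolding max_min_eq_scaled_pair[OF pos(1,2)] seiffert_mean_normal_form[OF pos]
        z_def[symmetric]
      using pos by (intro conjI mult_strict_left_mono) auto
  qed
  with seiffert_mean_in_means[OF f] show "seiffert_mean f \<in> strict_means"
    by (simp add: strict_means_def)
qed

theorem theorem2p1: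
  "bij_betw seiffert_mean seiffert_functions means \<and>
   seiffert_mean ` strict_seiffert_functions = strict_means"
proof
  show "bij_betw seiffert_mean seiffert_functions means"
    by (rule bij_betw_seiffert_mean)
  have image: "seiffert_mean ` seiffert_functions = means"
    using bij_betw_seiffert_mean by (simp add: bij_betw_def)
  have subsets: "strict_seiffert_functions \<subseteq> seiffert_functions" "strict_means \<subseteq> means"
    by (auto simp: strict_seiffert_functions_def strict_means_def)
  show "seiffert_mean ` strict_seiffert_functions = strict_means"
  proof
    show "seiffert_mean ` strict_seiffert_functions \<subseteq> strict_means"
      using subsets(1) seiffert_mean_strict_iff by blast
    show "strict_means \<subseteq> seiffert_mean ` strict_seiffert_functions"
    proof
      fix M assume M: "M \<in> strict_means"
      then obtain f where "f \<in> seiffert_functions" "M = seiffert_mean f"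
        using subsets(2) image by blast
      with M show "M \<in> seiffert_mean ` strict_seiffert_functions"
        using seiffert_mean_strict_iff by blast
    qed
  qed
qed

end
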